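(* Let $N\ge1$ and $m>0$. For a bounded, smooth test function $\phi\colon S(m)\to\mathbb R$ with compact support, $$\frac{e^{\beta h_*(m)}}{\beta^N}\mu^N_{\beta,m}\phi=\frac1{\beta^N}\int_{S(m)}e^{-\beta(H(\mathbf b)-h_*(m))}\phi(\mathbf b)\,\Gamma_m(d\mathbf b)=\frac1{\beta^N}\widehat\gamma^N_{\beta,m}\phi+\mathrm{Error}(m,N,\beta,\phi),$$ and there exists a constant $C(m,N)>0$, independent of $\phi$ and $\beta$, such that, for all sufficiently large $\beta$, $$|\mathrm{Error}(m,N,\beta,\phi)|\le C(m,N)\,\beta^{-1}\,\|\phi\|_{L^\infty(\Gamma_m)} .$$
   Context: Elements of $\mathbb C^{2N+1}$ are written $\mathbf b=(b_{-N},\dots,b_N)$, with $b_{-(N+1)}=b_{N+1}=0$. Set $H(\mathbf b)=\sum_{j=-N}^N\big(\tfrac12|b_j|^4-2\,\mathrm{Re}(\bar b_j^2b_{j-1}^2)\big)$, $M(\mathbf b)=\sum_{j=-N}^N|b_j|^2$, $S(m)=\{\mathbf b\in\mathbb C^{2N+1}:M(\mathbf b)=m\}$. $\mathbb C^{2N+1}$ is identified with $\mathbb R^{4N+2}$, with real inner product $\langle \mathbf u,\mathbf v\rangle=\mathrm{Re}\sum_j u_j\bar v_j$; $\nabla^2H(\mathbf b)$ is the real Hessian of $H$ on $\mathbb R^{4N+2}$. $\Gamma_m$ is the Riemannian surface measure on $S(m)$, of total mass $m^{2N+\frac12}\frac{2\pi^{2N+1}}{\mathrm{Gamma}(2N+1)}$.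 Define $\mu^N_{\beta,m}\phi=\int_{S(m)}\phi(\mathbf b)e^{-\beta H(\mathbf b)}\Gamma_m(d\mathbf b)$ and $h_*(m)=-\tfrac7{22}m^2$. For $k\in\{-N+1,\dots,N-1\}$, $\mathbf b_k(m)$ has entries $\sqrt{3m/11}$ at sites $k\pm1$, $\sqrt{5m/11}$ at site $k$, and $0$ elsewhere; $B_k^*(m)=\{e^{i\theta}\mathbf b_k(m):\theta\in[0,2\pi]\}$. Let $\widehat{\mathbf b}^*_k(\mathbf b)=\mathrm{argmin}_{\mathbf b^*\in B_k^*(m)}|\mathbf b-\mathbf b^*|$ (unique off a set of $\Gamma_m$-measure zero, on which a measurable selection is made), $\mathrm{Proj}_{\mathbf b^*_k}(\mathbf b)=\Big\langle\mathbf b,\frac{\widehat{\mathbf b}_k^*(\mathbf b)}{|\widehat{\mathbf b}_k^*(\mathbf b)|}\Big\rangle\frac{\widehat{\mathbf b}_k^*(\mathbf b)}{|\widehat{\mathbf b}_k^*(\mathbf b)|}$, $\mathrm{Proj}^\perp_{\mathbf b^*_k}(\mathbf b)=\mathbf b-\mathrm{Proj}_{\mathbf b^*_k}(\mathbf b)$, and $$G_k(\mathbf b)=\tfrac12\Big\langle\big(\tfrac{14}{11}M(\mathbf b)I+\nabla^2H(\widehat{\mathbf b}_k^*(\mathbf b))\big)\mathrm{Proj}^\perp_{\mathbf b^*_k}(\mathbf b),\ \mathrm{Proj}^\perp_{\mathbf b^*_k}(\mathbf b)\Big\rangle .$$ Finally $\widehat\gamma^N_{\beta,m}(d\mathbf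 b)=\sum_{k=-N+1}^{N-1}e^{-\beta G_k(\mathbf b)}\Gamma_m(d\mathbf b)$ and $\widehat\gamma^N_{\beta,m}\phi=\int_{S(m)}\phi\,d\widehat\gamma^N_{\beta,m}$. *)

theory Defs
  imports "HOL-Probability.Probability"
begin

text \<open>
  Vectors in complex (2N+1)-space are elements of \<^typ>\<open>complex^'n\<close>, where the index type has
  2N+1 elements and a bijection \<open>\<sigma>\<close> from \<^typ>\<open>'n\<close> onto \<open>{-N..N}\<close> names the sites.
  The library inner product on \<^typ>\<open>complex^'n\<close> is the real one, the real part of
  \<open>\<Sum>i. u\<^sub>i * cnj v\<^sub>i\<close> (see \<open>inner_eq_Re\<close>), and all derivatives and the measure \<^const>\<open>lborel\<close>
  are those of the underlying real Euclidean space of dimension 4N+2.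
\<close>

lemma inner_eq_Re: "inner u v = Re (\<Sum>i\<in>UNIV. u $ i * cnj (v $ i))"
  for u v :: "complex^'n::finite"
  by (simp add: inner_vec_def inner_complex_def)

text \<open>The convention that entries outside \<open>{-N..N}\<close> vanish is built into \<open>entry\<close>.\<close>

definition entry :: "('n::finite \<Rightarrow> int) \<Rightarrow> complex^'n \<Rightarrow> int \<Rightarrow> complex" where
  "entry \<sigma> b j = (if j \<in> range \<sigma> then b $ (inv \<sigma> j) else 0)"

definition H :: "nat \<Rightarrow> ('n::finite \<Rightarrow> int) \<Rightarrow> complex^'n \<Rightarrow> real" where
  "H N \<sigma> b = (\<Sum>j = - int N..int N.
     1/2 * cmod (entry \<sigma> b j) ^ 4 - 2 * Re ((cnj (entry \<sigma> b j))\<^sup>2 * (entry \<sigma> b (j - 1))\<^sup>2))"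

definition M :: "complex^'n::finite \<Rightarrow> real" where
  "M b = (\<Sum>i\<in>UNIV. (cmod (b $ i))\<^sup>2)"

definition S :: "real \<Rightarrow> (complex^'n::finite) set" where
  "S m = {b. M b = m}"

definition h_star :: "real \<Rightarrow> real" where
  "h_star m = - (7/22) * m\<^sup>2"

definition gradient :: "('a::real_inner \<Rightarrow> real) \<Rightarrow> 'a \<Rightarrow> 'a" where
  "gradient f x = (THE g. GDERIV f x :> g)"

definition hessian :: "('a::real_inner \<Rightarrow> real) \<Rightarrow> 'a \<Rightarrow> 'a \<Rightarrow> 'a" where
  "hessian f x = frechet_derivative (gradient f) (at x)"


lemma M_eq_norm: "M b = (norm b)\<^sup>2"
  by (simp add: M_def norm_vec_def L2_set_def sum_nonneg)

lemma S_eq_sphere: "m \<ge> 0 \<Longrightarrow> S m = sphere 0 (sqrt m)"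
  by (auto simp: S_def M_eq_norm real_sqrt_unique)

text \<open>
  The surface measure on the sphere \<open>S m\<close> of radius \<open>r = sqrt m\<close> in a space of dimension \<open>d\<close> is
  introduced by polar coordinates: the area of \<open>A\<close> is \<open>d / r\<close> times the Lebesgue measure of the
  cone over \<open>A\<close> with apex \<open>0\<close>, that is, it is \<open>d / r\<close> times the image of Lebesgue measure on the
  punctured ball under radial projection. It is shown below that this measure has the total mass
  of the Riemannian measure and, like it, is invariant under all orthogonal transformations.
  These two properties determine a Borel measure on the sphere.
\<close>

definition surface_measure :: "real \<Rightarrow> (complex^'n::finite) measure" where
  "surface_measure m =
     scale_measure (ennreal (real DIM(complex^'n) / sqrt m))
       (distr (restrict_space lborel (cball 0 (sqrt m) - {0})) (restrict_space borel (S m))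
          (\<lambda>x. (sqrt m / norm x) *\<^sub>R x))"

lemma space_surface_measure [simp]: "space (surface_measure m) = S m"
  by (simp add: surface_measure_def space_scale_measure space_restrict_space)

lemma sets_surface_measure [measurable_cong]:
  "sets (surface_measure m) = sets (restrict_space borel (S m))"
  by (simp add: surface_measure_def)

lemma radial_measurable:
  assumes "m > 0"
  shows "(\<lambda>x. (sqrt m / norm x) *\<^sub>R x) \<in>
    measurable (restrict_space lborel (cball 0 (sqrt m) - {0})) (restrict_space borel (S m))"
proof (rule measurable_restrict_space2)
  show "(\<lambda>x. (sqrt m / norm x) *\<^sub>R x) \<in>
      space (restrict_space lborel (cball 0 (sqrt m) - {0})) \<rightarrow> S m"
    using assms by (auto simp: S_eq_sphere space_restrict_space)
  show "(\<lambda>x. (sqrt m / norm x) *\<^sub>R x) \<in>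
      borel_measurable (restrict_space lborel (cball 0 (sqrt m) - {0}))"
    by (rule measurable_restrict_space1) measurable
qed

lemma emeasure_surface_measure:
  assumes "m > 0" and A: "A \<in> sets (restrict_space borel (S m))"
  shows "emeasure (surface_measure m) A =
    ennreal (real DIM(complex^'n::finite) / sqrt m) *
    emeasure lborel {x :: complex^'n. x \<noteq> 0 \<and> norm x \<le> sqrt m \<and> (sqrt m / norm x) *\<^sub>R x \<in> A}"
proof -
  have "emeasure (distr (restrict_space lborel (cball 0 (sqrt m) - {0})) (restrict_space borel (S m))
          (\<lambda>x. (sqrt m / norm x) *\<^sub>R x)) A
      = emeasure lborel
          ((\<lambda>x. (sqrt m / norm x) *\<^sub>R x) -` A \<inter> (cball 0 (sqrt m) - {0} :: (complex^'n) set))"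
    using A by (simp add: emeasure_distr radial_measurable[OF assms(1)] emeasure_restrict_space
        space_restrict_space)
  also have "(\<lambda>x. (sqrt m / norm x) *\<^sub>R x) -` A \<inter> (cball 0 (sqrt m) - {0} :: (complex^'n) set)
      = {x. x \<noteq> 0 \<and> norm x \<le> sqrt m \<and> (sqrt m / norm x) *\<^sub>R x \<in> A}"
    by auto
  finally show ?thesis
    by (simp add: surface_measure_def)
qed

lemma surface_measure_total_mass:
  assumes "m > 0" and N: "CARD('n) = 2 * N + 1"
  shows "emeasure (surface_measure m) (S m :: (complex^'n::finite) set) =
    ennreal (m powr (2 * real N + 1/2) * (2 * pi ^ (2 * N + 1) / Gamma (2 * real N + 1)))"
proof -
  let ?d = "real (4 * N + 2)"
  have d: "DIM(complex^'n) = 4 * N + 2"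
    using N by simp
  have inS: "(S m :: (complex^'n) set) \<in> sets (restrict_space borel (S m))"
    using sets.top[of "restrict_space borel (S m :: (complex^'n) set)"]
    by (simp add: space_restrict_space)
  have eq: "{x :: complex^'n. x \<noteq> 0 \<and> norm x \<le> sqrt m \<and> (sqrt m / norm x) *\<^sub>R x \<in> S m}
      = cball 0 (sqrt m) - {0}"
    using \<open>m > 0\<close> by (auto simp: S_eq_sphere)
  have "emeasure lborel (cball 0 (sqrt m) - {0} :: (complex^'n) set)
      = emeasure lborel (cball 0 (sqrt m) :: (complex^'n) set)"
    by (rule emeasure_Diff_null_set) (auto simp: null_sets_def)
  also have "\<dots> = ennreal (unit_ball_vol ?d * sqrt m ^ (4 * N + 2))"
    using \<open>m > 0\<close> by (subst emeasure_cball) (simp_all only: d real_sqrt_ge_0_iff less_imp_le)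
  finally have cone: "emeasure lborel (cball 0 (sqrt m) - {0} :: (complex^'n) set)
      = ennreal (unit_ball_vol ?d * sqrt m ^ (4 * N + 2))" .
  have "emeasure (surface_measure m) (S m :: (complex^'n) set)
      = ennreal (?d / sqrt m) * ennreal (unit_ball_vol ?d * sqrt m ^ (4 * N + 2))"
    unfolding emeasure_surface_measure[OF \<open>m > 0\<close> inS] eq cone d ..
  also have "\<dots> = ennreal (?d / sqrt m * (unit_ball_vol ?d * sqrt m ^ (4 * N + 2)))"
    using \<open>m > 0\<close> by (subst ennreal_mult) (auto intro!: mult_nonneg_nonneg)
  also have "?d / sqrt m * (unit_ball_vol ?d * sqrt m ^ (4 * N + 2))
      = m powr (2 * real N + 1/2) * (2 * pi ^ (2 * N + 1) / Gamma (2 * real N + 1))"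
  proof -
    have "Gamma ((2 * real N + 1) + 1) = (2 * real N + 1) * Gamma (2 * real N + 1)"
      by (rule Gamma_plus1) (auto elim!: nonpos_Ints_cases)
    moreover have d2: "?d / 2 = 2 * real N + 1" by simp
    moreover have "pi powr (2 * real N + 1) = pi ^ (2 * N + 1)"
      using powr_realpow[of pi "2 * N + 1"] by (simp add: add.commute)
    ultimately have vol:
      "unit_ball_vol ?d = pi ^ (2 * N + 1) / ((2 * real N + 1) * Gamma (2 * real N + 1))"
      unfolding unit_ball_vol_def d2 by simp
    have "sqrt m ^ (4 * N + 2) / sqrt m = sqrt m ^ (4 * N + 1)"
      using \<open>m > 0\<close> by simp
    also have "\<dots> = sqrt m powr (4 * real N + 1)"
      using \<open>m > 0\<close> powr_realpow[of "sqrt m" "4 * N + 1"] by (simp add: add.commute)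
    also have "\<dots> = m powr (2 * real N + 1/2)"
      using \<open>m > 0\<close> by (simp add: powr_half_sqrt[symmetric] powr_powr add_divide_distrib)
    finally have pow: "sqrt m ^ (4 * N + 2) / sqrt m = m powr (2 * real N + 1/2)" .
    have "?d / sqrt m * (unit_ball_vol ?d * sqrt m ^ (4 * N + 2))
        = (sqrt m ^ (4 * N + 2) / sqrt m) * (?d * unit_ball_vol ?d)"
      by simp
    also have "?d * unit_ball_vol ?d = 2 * pi ^ (2 * N + 1) / Gamma (2 * real N + 1)"
      unfolding vol by (simp add: divide_simps)
    finally show ?thesis by (simp only: pow)
  qed
  finally show ?thesis .
qed


lemma distr_orthogonal:
  fixes T :: "'a::euclidean_space \<Rightarrow> 'a"
  assumes T: "orthogonal_transformation T"
  shows "distr lborel borel T = lborel"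
proof (rule measure_eqI)
  have lin: "linear T" and nT: "norm (T x) = norm x" for x
    using T by (auto simp: orthogonal_transformation)
  have Tm [measurable]: "T \<in> borel_measurable borel"
    using lin by (intro borel_measurable_continuous_onI linear_continuous_on) (simp add: linear_linear)
  have shift: "(\<integral>\<^sup>+x. f (t + x) \<partial>lborel) = (\<integral>\<^sup>+x. f x \<partial>lborel)"
    if [measurable]: "f \<in> borel_measurable borel" for f :: "'a \<Rightarrow> ennreal" and t
    by (subst lborel_distr_plus[of t, symmetric]) (simp add: nn_integral_distr)
  have refl: "(\<integral>\<^sup>+x. f (- x) \<partial>lborel) = (\<integral>\<^sup>+x. f x \<partial>lborel)"
    if [measurable]: "f \<in> borel_measurable borel" for f :: "'a \<Rightarrow> ennreal"
    by (subst (2) lborel_affine[of "-1" 0]) (simp_all add: nn_integral_density nn_integral_distr)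
  fix A :: "'a set"
  assume "A \<in> sets (distr lborel borel T)"
  then have [measurable]: "A \<in> sets borel" by simp
  let ?B = "ball 0 1 :: 'a set"
  have [measurable]: "?B \<in> sets borel" by simp
  have B: "indicator ?B (T x) = (indicator ?B x :: ennreal)" for x
    by (simp add: indicator_def nT)
  have "(\<integral>\<^sup>+x. indicator A (T x) \<partial>lborel) * emeasure lborel ?B
      = (\<integral>\<^sup>+x. indicator A (T x) * (\<integral>\<^sup>+y. indicator ?B y \<partial>lborel) \<partial>lborel)"
    by (simp add: nn_integral_multc)
  also have "\<dots> = (\<integral>\<^sup>+x. (\<integral>\<^sup>+y. indicator A (T x) * indicator ?B (T x + y) \<partial>lborel) \<partial>lborel)"
  proof (rule nn_integral_cong)
    fix x
    have "(\<integral>\<^sup>+y. indicator A (T x) * indicator ?B (T x + y) \<partial>lborel)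
        = indicator A (T x) * (\<integral>\<^sup>+y. indicator ?B (T x + y) \<partial>lborel)"
      by (rule nn_integral_cmult) measurable
    then show "indicator A (T x) * (\<integral>\<^sup>+y. indicator ?B y \<partial>lborel)
        = (\<integral>\<^sup>+y. indicator A (T x) * indicator ?B (T x + y) \<partial>lborel)"
      by (subst (asm) shift) simp_all
  qed
  also have "\<dots> = (\<integral>\<^sup>+y. (\<integral>\<^sup>+x. indicator A (T x) * indicator ?B (T x + y) \<partial>lborel) \<partial>lborel)"
    by (rule lborel_pair.Fubini') simp
  also have "\<dots> = (\<integral>\<^sup>+y. (\<integral>\<^sup>+x. indicator A (T x - y) * indicator ?B (T x) \<partial>lborel) \<partial>lborel)"
  proof (rule nn_integral_cong)
    fix y :: 'a
    obtain z where z: "T z = y"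
      using orthogonal_transformation_surj[OF T] by (metis surjD)
    have "(\<integral>\<^sup>+x. indicator A (T x - y) * indicator ?B (T x) \<partial>lborel)
        = (\<integral>\<^sup>+x. indicator A (T (z + x) - y) * (indicator ?B (T (z + x)) :: ennreal) \<partial>lborel)"
      by (rule shift[symmetric]) simp
    then show "(\<integral>\<^sup>+x. indicator A (T x) * indicator ?B (T x + y) \<partial>lborel)
        = (\<integral>\<^sup>+x. indicator A (T x - y) * (indicator ?B (T x) :: ennreal) \<partial>lborel)"
      by (simp add: linear_add[OF lin] z add.commute)
  qed
  also have "\<dots> = (\<integral>\<^sup>+x. (\<integral>\<^sup>+y. indicator A (T x - y) * indicator ?B (T x) \<partial>lborel) \<partial>lborel)"
    by (rule lborel_pair.Fubini') simp
  also have "\<dots> = (\<integral>\<^sup>+x. emeasure lborel A * indicator ?B x \<partial>lborel)"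
  proof (rule nn_integral_cong)
    fix x
    have "(\<integral>\<^sup>+y. indicator A (T x - y) \<partial>lborel) = (\<integral>\<^sup>+y. indicator A (T x + y) \<partial>lborel)"
      using refl[of "\<lambda>y. indicator A (T x + y)"] by simp
    also have "\<dots> = emeasure lborel A"
      by (subst shift[of "indicator A"]) simp_all
    finally show "(\<integral>\<^sup>+y. indicator A (T x - y) * indicator ?B (T x) \<partial>lborel)
        = emeasure lborel A * indicator ?B x"
      by (simp add: nn_integral_multc B)
  qed
  also have "\<dots> = emeasure lborel A * emeasure lborel ?B"
    by (simp add: nn_integral_cmult)
  finally have "(\<integral>\<^sup>+x. indicator A (T x) \<partial>lborel) * emeasure lborel ?B
      = emeasure lborel A * emeasure lborel ?B" .
  moreover have "unit_ball_vol (real DIM('a)) \<noteq> 0"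
    using unit_ball_vol_pos[of "real DIM('a)"] by (metis less_irrefl of_nat_0_le_iff)
  then have "emeasure lborel ?B \<noteq> 0" "emeasure lborel ?B \<noteq> top"
    by (auto simp: emeasure_ball)
  ultimately have "(\<integral>\<^sup>+x. indicator A (T x) \<partial>lborel) = emeasure lborel A"
    using ennreal_mult_cancel_left[of "emeasure lborel ?B"] by (metis mult.commute)
  also have "(\<integral>\<^sup>+x. indicator A (T x) \<partial>lborel) = (\<integral>\<^sup>+x. indicator A x \<partial>distr lborel borel T)"
    by (rule nn_integral_distr[symmetric]) simp_all
  finally show "emeasure (distr lborel borel T) A = emeasure lborel A"
    by simp
qed simp

lemma surface_measure_orthogonal_invariant:
  fixes T :: "complex^'n::finite \<Rightarrow> complex^'n"
  assumes "m > 0" and T: "orthogonal_transformation T"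
    and A: "A \<in> sets (restrict_space borel (S m))"
  shows "emeasure (surface_measure m) (T -` A) = emeasure (surface_measure m) A"
proof -
  let ?C = "\<lambda>A. {x :: complex^'n. x \<noteq> 0 \<and> norm x \<le> sqrt m \<and> (sqrt m / norm x) *\<^sub>R x \<in> A}"
  have lin: "linear T" and nT: "norm (T x) = norm x" for x
    using T by (auto simp: orthogonal_transformation)
  have Tm [measurable]: "T \<in> borel_measurable borel"
    using lin by (intro borel_measurable_continuous_onI linear_continuous_on) (simp add: linear_linear)
  have Sb: "(S m :: (complex^'n) set) \<in> sets borel"
    using \<open>m > 0\<close> by (simp add: S_eq_sphere borel_closed)
  have AS: "A \<subseteq> S m" and Ab [measurable]: "A \<in> sets borel"
    using A Sb by (auto simp: sets_restrict_space_iff)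
  have "T -` A \<in> sets borel"
    using measurable_sets[OF Tm Ab] by simp
  moreover have "T -` A \<subseteq> S m"
    using AS \<open>m > 0\<close> by (auto simp: S_eq_sphere nT)
  ultimately have A': "T -` A \<in> sets (restrict_space borel (S m))"
    using Sb by (auto simp: sets_restrict_space_iff)
  have C: "?C (T -` A) = T -` ?C A"
    using nT by (auto simp: linear_scale[OF lin]) (metis norm_eq_zero)+
  have "?C A \<in> sets borel"
    by measurable
  then have "emeasure (distr lborel borel T) (?C A) = emeasure lborel (T -` ?C A)"
    by (subst emeasure_distr) auto
  then show ?thesis
    unfolding emeasure_surface_measure[OF \<open>m > 0\<close> A'] emeasure_surface_measure[OF \<open>m > 0\<close> A] C
    by (simp add: distr_orthogonal[OF T])
qed


definition mu :: "nat \<Rightarrow> ('n::finite \<Rightarrow> int) \<Rightarrow> real \<Rightarrow> real \<Rightarrow> (complex^'n \<Rightarrow> real) \<Rightarrow> real" where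
  "mu N \<sigma> \<beta> m \<phi> = (\<integral>b. \<phi> b * exp (- \<beta> * H N \<sigma> b) \<partial>surface_measure m)"

definition bvec :: "('n::finite \<Rightarrow> int) \<Rightarrow> int \<Rightarrow> real \<Rightarrow> complex^'n" where
  "bvec \<sigma> k m = (\<chi> i. if \<sigma> i = k then of_real (sqrt (5 * m / 11))
                     else if \<sigma> i = k - 1 \<or> \<sigma> i = k + 1 then of_real (sqrt (3 * m / 11))
                     else 0)"

definition Bset :: "('n::finite \<Rightarrow> int) \<Rightarrow> int \<Rightarrow> real \<Rightarrow> (complex^'n) set" where
  "Bset \<sigma> k m = {exp (\<i> * of_real \<theta>) *s bvec \<sigma> k m | \<theta>. \<theta> \<in> {0..2 * pi}}"

text \<open>
  The nearest point of \<open>Bset\<close> need not be unique on a null set; a measurable selection of nearest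
  points is a parameter \<open>bhat\<close> of the following definitions. Selections exist: see below.
\<close>

definition nearest_point_selection ::
  "('n::finite \<Rightarrow> int) \<Rightarrow> int \<Rightarrow> real \<Rightarrow> (complex^'n \<Rightarrow> complex^'n) \<Rightarrow> bool" where
  "nearest_point_selection \<sigma> k m bhat \<longleftrightarrow>
     bhat \<in> borel_measurable (surface_measure m) \<and>
     (\<forall>b\<in>S m. is_arg_min (\<lambda>b'. norm (b - b')) (\<lambda>b'. b' \<in> Bset \<sigma> k m) (bhat b))"

lemma nearest_point_selection_exists: "\<exists>bhat. nearest_point_selection \<sigma> k m bhat"
proof -
  define v where "v = bvec \<sigma> k m"
  define c where "c b = (\<Sum>i\<in>UNIV. b $ i * cnj (v $ i))" for b
  define bhat where "bhat b = (if c b = 0 then v else (c b / of_real (cmod (c b))) *s v)" for b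
  have B: "Bset \<sigma> k m = {z *s v | z. cmod z = 1}"
  proof -
    have "\<exists>\<theta>\<in>{0..2 * pi}. z = exp (\<i> * of_real \<theta>)" if "cmod z = 1" for z
      using that Arg2pi_ge_0[of z] Arg2pi_lt_2pi[of z] Arg2pi_eq[of z]
      by (intro bexI[of _ "Arg2pi z"]) auto
    then show ?thesis
      unfolding Bset_def v_def[symmetric] by fastforce
  qed
  have ip: "b \<bullet> (z *s v) = Re (cnj z * c b)" for b z
    unfolding inner_eq_Re c_def by (simp add: sum_distrib_left mult_ac)
  have nz: "norm (z *s v) = norm v" if "cmod z = 1" for z
    using that by (simp add: norm_vec_def norm_mult)
  have d: "(norm (b - z *s v))\<^sup>2 = (norm b)\<^sup>2 + (norm v)\<^sup>2 - 2 * Re (cnj z * c b)"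
    if "cmod z = 1" for b z
    using dot_norm_neg[of b "z *s v"] nz[OF that] by (simp add: ip)
  have "is_arg_min (\<lambda>b'. norm (b - b')) (\<lambda>b'. b' \<in> Bset \<sigma> k m) (bhat b)" for b
  proof -
    define w where "w = (if c b = 0 then 1 else c b / of_real (cmod (c b)))"
    have w1: "cmod w = 1"
      by (simp add: w_def norm_divide)
    have bh: "bhat b = w *s v"
      by (simp add: bhat_def w_def)
    have wc: "Re (cnj w * c b) = cmod (c b)"
    proof (cases "c b = 0")
      case False
      then have "cnj w * c b = of_real (cmod (c b))"
        by (simp add: w_def complex_norm_square[symmetric] power2_eq_square mult.commute[of "cnj _"]
            divide_simps flip: of_real_mult)
      then show ?thesis by simp
    qed (simp add: w_def)
    have "norm (b - w *s v) \<le> norm (b - z *s v)" if "cmod z = 1" for z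
    proof (rule power2_le_imp_le)
      have "Re (cnj z * c b) \<le> cmod (c b)"
        using complex_Re_le_cmod[of "cnj z * c b"] that by (simp add: norm_mult)
      then show "(norm (b - w *s v))\<^sup>2 \<le> (norm (b - z *s v))\<^sup>2"
        unfolding d[OF that] d[OF w1] wc by simp
    qed simp
    then show ?thesis
      unfolding is_arg_min_def B bh using w1 by (auto simp: not_less)
  qed
  moreover have "bhat \<in> borel_measurable (surface_measure m)"
  proof -
    have [measurable]: "(\<lambda>b. b $ i) \<in> borel_measurable borel" for i :: 'a
      by (intro borel_measurable_continuous_onI continuous_intros)
    have [measurable]: "c \<in> borel_measurable borel"
      unfolding c_def by measurable
    have [measurable]: "(\<lambda>z. z *s v) \<in> borel_measurable borel"
      unfolding vector_scalar_mult_def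
      by (intro borel_measurable_continuous_onI continuous_intros)
    have "bhat \<in> borel_measurable borel"
      unfolding bhat_def by measurable
    then have "bhat \<in> borel_measurable (restrict_space borel (S m))"
      by (rule measurable_restrict_space1)
    then show ?thesis
      by (simp cong: measurable_cong_sets add: measurable_cong_sets[OF sets_surface_measure refl])
  qed
  ultimately show ?thesis
    unfolding nearest_point_selection_def by blast
qed

definition Proj :: "('a::real_inner \<Rightarrow> 'a) \<Rightarrow> 'a \<Rightarrow> 'a" where
  "Proj bhat b = (b \<bullet> (bhat b /\<^sub>R norm (bhat b))) *\<^sub>R (bhat b /\<^sub>R norm (bhat b))"

definition Proj_perp :: "('a::real_inner \<Rightarrow> 'a) \<Rightarrow> 'a \<Rightarrow> 'a" where
  "Proj_perp bhat b = b - Proj bhat b"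

definition G :: "nat \<Rightarrow> ('n::finite \<Rightarrow> int) \<Rightarrow> (complex^'n \<Rightarrow> complex^'n) \<Rightarrow> complex^'n \<Rightarrow> real" where
  "G N \<sigma> bhat b = 1/2 *
     (((14/11 * M b) *\<^sub>R Proj_perp bhat b + hessian (H N \<sigma>) (bhat b) (Proj_perp bhat b))
        \<bullet> Proj_perp bhat b)"

definition gamma_hat ::
  "nat \<Rightarrow> ('n::finite \<Rightarrow> int) \<Rightarrow> (int \<Rightarrow> complex^'n \<Rightarrow> complex^'n) \<Rightarrow> real \<Rightarrow> real \<Rightarrow> (complex^'n) measure"
  where
  "gamma_hat N \<sigma> bhat \<beta> m = density (surface_measure m)
     (\<lambda>b. ennreal (\<Sum>k = - int N + 1..int N - 1. exp (- \<beta> * G N \<sigma> (bhat k) b)))"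


text \<open>
  \<open>Ck_on k f U\<close>, for open \<open>U\<close> in a Euclidean space: \<open>f\<close> is \<open>k\<close> times continuously
  differentiable on \<open>U\<close>.
\<close>

fun Ck_on :: "nat \<Rightarrow> ('a::euclidean_space \<Rightarrow> real) \<Rightarrow> 'a set \<Rightarrow> bool" where
  "Ck_on 0 f U \<longleftrightarrow> continuous_on U f"
| "Ck_on (Suc k) f U \<longleftrightarrow> (\<forall>x\<in>U. f differentiable (at x)) \<and>
     (\<forall>v. Ck_on k (\<lambda>x. frechet_derivative f (at x) v) U)"

text \<open>Smoothness on an embedded submanifold: locally the restriction of a smooth function.\<close>

definition smooth_on :: "'a::euclidean_space set \<Rightarrow> ('a \<Rightarrow> real) \<Rightarrow> bool" where
  "smooth_on X f \<longleftrightarrow>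
     (\<forall>x\<in>X. \<exists>U g. open U \<and> x \<in> U \<and> (\<forall>k. Ck_on k g U) \<and> (\<forall>y\<in>X \<inter> U. g y = f y))"

text \<open>Only the values of \<open>\<phi>\<close> on \<open>S m\<close> matter.\<close>

definition test_function :: "real \<Rightarrow> (complex^'n::finite \<Rightarrow> real) \<Rightarrow> bool" where
  "test_function m \<phi> \<longleftrightarrow> smooth_on (S m) \<phi> \<and> bounded (\<phi> ` S m) \<and>
     compact (closure {b \<in> S m. \<phi> b \<noteq> 0})"

definition Linf_norm :: "'a measure \<Rightarrow> ('a \<Rightarrow> real) \<Rightarrow> real" where
  "Linf_norm \<Gamma> \<phi> = enn2real (esssup \<Gamma> (\<lambda>b. ennreal \<bar>\<phi> b\<bar>))"

end

theory Submission
  imports Defs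
begin

text \<open>
  Both exponents are nonpositive on the sphere: \<open>H \<ge> h_star m\<close> there, and every \<open>G\<^sub>k\<close> is nonnegative.
  Each of the \<open>2N\<close> integrals being compared is therefore at most the total area of the sphere times
  the essential supremum of the test function, whatever \<open>\<beta>\<close> is. Since \<open>N \<ge> 1\<close>, the prefactor
  \<open>1 / \<beta> ^ N\<close> is at most \<open>1 / \<beta>\<close> as soon as \<open>\<beta> \<ge> 1\<close>, so the constant can be taken to be \<open>2N\<close>
  times the area (plus \<open>1\<close>, to make it visibly positive). The content is in
  the two sign statements.

  The first one, \<open>H_lower_bound\<close>, is the determination of the ground state energy. The interaction
  is most favourable when the phases are aligned, and then \<open>H\<close> is a quadratic form in the masses
  \<open>x\<^sub>j = \<bar>b\<^sub>j\<bar>\<^sup>2\<close> of a chain. Along the mass-preserving direction \<open>(2, 1, -1, -2)\<close> on four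
  consecutive sites this form is strictly concave, so mass can be moved until one of the four sites
  is empty without raising the energy. An empty site cuts the chain into two shorter chains that do
  not interact, and by concavity of \<open>m \<mapsto> - m\<^sup>2\<close> one chain does better than two. Only chains of at most
  three sites remain (\<open>chain_energy_lower_bound\<close>); there the form is handled by completing squares,
  with equality for masses in proportion \<open>3 : 5 : 3\<close>, which are those of \<open>b\<^sub>k\<close>.

  The second one, \<open>G_nonneg\<close>, is a consequence of the first. The function \<open>H + 7/22 M\<^sup>2\<close> is
  nonnegative on the whole space and vanishes on the circle \<open>B\<^sub>k\<close>, so its Hessian is positive
  semidefinite there. On vectors orthogonal to the base point \<open>b\<^sup>*\<close> the Hessian of \<open>7/22 M\<^sup>2\<close> reduces to
  \<open>14/11 M I\<close>, because the rank-one part in the direction of \<open>b\<^sup>*\<close> drops out; the form is then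
  exactly twice \<open>G\<^sub>k\<close>.

  The gradient and the Hessian of \<open>H\<close> are computed in closed form. This shows at the same time that
  they exist and that \<open>G\<^sub>k\<close> is measurable, which is what allows the integral against the density
  \<open>gamma_hat\<close> to be written as a sum of integrals over the sphere.
\<close>

section \<open>Energy of a chain of masses\<close>

text \<open>
  The argument \<open>p\<close> is the mass of the site to the left of the list. Carrying it along makes the
  recursion agree with \<open>H\<close>, in which each site interacts with its left neighbour, and \<open>p = 0\<close>
  is the convention that the first site has none.
\<close>

fun chain_energy :: "real \<Rightarrow> real list \<Rightarrow> real" where
  "chain_energy p [] = 0"
| "chain_energy p (x # xs) = x\<^sup>2 / 2 - 2 * x * p + chain_energy x xs"

lemma chain_energy_split_at_zero:
  "chain_energy p (xs @ 0 # ys) = chain_energy p xs + chain_energy 0 ys"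
  by (induction xs arbitrary: p) auto

lemma chain_energy_left_neighbour:
  "chain_energy p xs = chain_energy 0 xs - 2 * p * (case xs of [] \<Rightarrow> 0 | x # _ \<Rightarrow> x)"
  by (cases xs) auto

text \<open>
  The direction \<open>(2, 1, -1, -2)\<close> conserves the total mass and has second-order coefficient
  \<open>(4 + 1 + 1 + 4) / 2 - 2 * (2 - 1 + 2) = - 1\<close>. Along it the energy is concave, hence it does not
  increase in at least one of the two orientations, and one can go on until the constraint
  of nonnegative masses becomes active.
\<close>

lemma vacate_site:
  fixes a b c d :: real
  assumes "0 \<le> a" "0 \<le> b" "0 \<le> c" "0 \<le> d"
  obtains t where "0 \<le> a + 2 * t" "0 \<le> b + t" "0 \<le> c - t" "0 \<le> d - 2 * t"
    and "a + 2 * t = 0 \<or> b + t = 0 \<or> c - t = 0 \<or> d - 2 * t = 0"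
    and "chain_energy 0 ((a + 2 * t) # (b + t) # (c - t) # (d - 2 * t) # xs) \<le> chain_energy 0 (a # b # c # d # xs)"
proof -
  \<comment> \<open>\<open>h\<close> is the mass of the fifth site (\<open>0\<close> if there is none), the only one outside the window whose interaction changes;
     \<open>l\<close> is the slope at \<open>t = 0\<close>, and its sign selects the orientation.\<close>
  define h where "h = (case xs of [] \<Rightarrow> 0 | x # _ \<Rightarrow> x)"
  define l where "l = c - b + 4 * h"
  have q: "chain_energy 0 ((a + 2 * t) # (b + t) # (c - t) # (d - 2 * t) # xs)
      = chain_energy 0 (a # b # c # d # xs) + l * t - t\<^sup>2" for t
    using chain_energy_left_neighbour[of "d - 2 * t" xs] chain_energy_left_neighbour[of d xs]
    unfolding h_def[symmetric] l_def by (simp add: field_simps power2_eq_square)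
  define t where "t = (if l \<le> 0 then min c (d / 2) else - min (a / 2) b)"
  have "l * t \<le> 0"
  proof (cases "l \<le> 0")
    case True
    then show ?thesis
      using assms by (simp add: t_def mult_nonpos_nonneg)
  next
    case False
    then show ?thesis
      using assms by (simp add: t_def)
  qed
  then have "chain_energy 0 ((a + 2 * t) # (b + t) # (c - t) # (d - 2 * t) # xs)
      \<le> chain_energy 0 (a # b # c # d # xs)"
    using q[of t] zero_le_power2[of t] by linarith
  moreover have "0 \<le> a + 2 * t" "0 \<le> b + t" "0 \<le> c - t" "0 \<le> d - 2 * t"
    "a + 2 * t = 0 \<or> b + t = 0 \<or> c - t = 0 \<or> d - 2 * t = 0"
    using assms by (simp_all add: t_def min_def)
  ultimately show ?thesis
    using that by blast
qed

text \<open>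
  Induction on the length: a chain with four or more sites may be assumed to contain an empty one,
  and is then cut there into two chains that are both shorter. On three sites \<open>a, b, c\<close> the
  inequality, multiplied by \<open>22\<close>, becomes
  \<open>18 (a\<^sup>2 + b\<^sup>2 + c\<^sup>2) - 30 (a b + b c) + 14 a c \<ge> 0\<close>, and twice the left-hand side is
  \<open>(6 b - 5 a - 5 c)\<^sup>2 + 11 (a - c)\<^sup>2\<close>.
\<close>

lemma chain_energy_lower_bound:
  assumes "\<forall>x\<in>set xs. 0 \<le> x"
  shows "- (7/22) * (sum_list xs)\<^sup>2 \<le> chain_energy 0 xs"
  using assms
proof (induction xs rule: length_induct)
  case (1 xs)
  consider "xs = []" | a where "xs = [a]" | a b where "xs = [a, b]" | a b c where "xs = [a, b, c]"
    | a b c d ys where "xs = a # b # c # d # ys"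
    by (metis list.exhaust)
  then show ?case
  proof cases
    case (2 a)
    have "- (7/22) * a\<^sup>2 \<le> a\<^sup>2 / 2"
      using zero_le_power2[of a] by linarith
    then show ?thesis
      using 2 by simp
  next
    case (3 a b)
    have "0 \<le> 9 * (a - b)\<^sup>2" by simp
    also have "\<dots> \<le> 9 * (a - b)\<^sup>2 + 3 * (a * b)"
      using 1(2) 3 by simp
    finally show ?thesis
      using 3 by (simp add: power2_eq_square field_simps)
  next
    case (4 a b c)
    have "0 \<le> (6 * b - 5 * a - 5 * c)\<^sup>2 + 11 * (a - c)\<^sup>2"
      by simp
    then have "0 \<le> 18 * (a\<^sup>2 + b\<^sup>2 + c\<^sup>2) - 30 * (a * b + b * c) + 14 * (a * c)"
      by (simp add: power2_eq_square algebra_simps)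
    then show ?thesis
      using 4 by (simp add: power2_eq_square field_simps)
  next
    case (5 a b c d ys)
    obtain t where nonneg: "0 \<le> a + 2 * t" "0 \<le> b + t" "0 \<le> c - t" "0 \<le> d - 2 * t"
      and zero: "a + 2 * t = 0 \<or> b + t = 0 \<or> c - t = 0 \<or> d - 2 * t = 0"
      and le: "chain_energy 0 ((a + 2 * t) # (b + t) # (c - t) # (d - 2 * t) # ys) \<le> chain_energy 0 xs"
      using vacate_site[of a b c d ys] 1(2) unfolding 5 by auto
    define xs' where "xs' = (a + 2 * t) # (b + t) # (c - t) # (d - 2 * t) # ys"
    have sum: "sum_list xs' = sum_list xs"
      by (simp add: xs'_def 5)
    have nonneg': "\<forall>x\<in>set xs'. 0 \<le> x"
      using nonneg 1(2) by (auto simp: xs'_def 5)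
    have "0 \<in> set xs'"
      using zero by (auto simp: xs'_def)
    then obtain us vs where split: "xs' = us @ 0 # vs"
      by (meson split_list)
    have len: "length us < length xs" "length vs < length xs"
      using arg_cong[OF split, of length] by (auto simp: xs'_def 5)
    have "0 \<le> sum_list us * sum_list vs"
      using nonneg' by (intro mult_nonneg_nonneg sum_list_nonneg) (auto simp: split)
    then have "- (7/22) * (sum_list us + sum_list vs)\<^sup>2
        \<le> - (7/22) * (sum_list us)\<^sup>2 + - (7/22) * (sum_list vs)\<^sup>2"
      by (simp add: power2_sum field_simps)
    also have "\<dots> \<le> chain_energy 0 us + chain_energy 0 vs"
      using 1(1) len nonneg' by (intro add_mono) (auto simp: split)
    also have "\<dots> = chain_energy 0 xs'"
      by (simp add: split chain_energy_split_at_zero)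
    also have "\<dots> \<le> chain_energy 0 xs"
      using le by (simp add: xs'_def)
    finally show ?thesis
      by (simp add: sum[symmetric] split)
  qed auto
qed

section \<open>The minimum of H on the sphere\<close>

lemma chain_energy_upto:
  "chain_energy (f (a - 1)) (map f [a..b])
     = (\<Sum>j = a..b. (f j)\<^sup>2 / 2 - 2 * f j * f (j - 1))"
proof (induction a b rule: upto.induct)
  case (1 a b)
  show ?case
  proof (cases "a \<le> b")
    case True
    then have "{a..b} = insert a {a + 1..b}" by auto
    then show ?thesis
      using 1[OF True] True by (simp add: upto_rec1)
  qed simp
qed

lemma sum_list_map_upto: "sum_list (map f [a..b]) = sum f {a..b}"
  for f :: "int \<Rightarrow> 'a::comm_monoid_add"
  by (simp add: sum_list_distinct_conv_sum_set)

lemma M_eq_sum_entry: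
  assumes "bij_betw \<sigma> UNIV {- int N..int N}"
  shows "M b = (\<Sum>j = - int N..int N. (cmod (entry \<sigma> b j))\<^sup>2)"
proof -
  have "inj \<sigma>"
    using assms by (simp add: bij_betw_def)
  then have "M b = (\<Sum>i\<in>UNIV. (cmod (entry \<sigma> b (\<sigma> i)))\<^sup>2)"
    by (simp add: M_def entry_def)
  also have "\<dots> = (\<Sum>j = - int N..int N. (cmod (entry \<sigma> b j))\<^sup>2)"
    by (rule sum.reindex_bij_betw[OF assms])
  finally show ?thesis .
qed

text \<open>
  The interaction \<open>Re (cnj b\<^sub>j\<^sup>2 * b\<^sub>j\<^sub>-\<^sub>1\<^sup>2)\<close> is largest when the phases are aligned, which replaces
  \<open>H\<close> by the chain energy of the squared moduli.
\<close>

lemma H_lower_bound: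
  assumes "bij_betw \<sigma> UNIV {- int N..int N}"
  shows "- (7/22) * (M b)\<^sup>2 \<le> H N \<sigma> b"
proof -
  define f where "f j = (cmod (entry \<sigma> b j))\<^sup>2" for j
  have "range \<sigma> = {- int N..int N}"
    using assms by (auto simp: bij_betw_def)
  then have f0: "f (- int N - 1) = 0"
    by (simp add: f_def entry_def)
  have "- (7/22) * (M b)\<^sup>2 \<le> chain_energy 0 (map f [- int N..int N])"
    using chain_energy_lower_bound[of "map f [- int N..int N]"]
    by (simp add: M_eq_sum_entry[OF assms] sum_list_map_upto f_def)
  also have "\<dots> = (\<Sum>j = - int N..int N. (f j)\<^sup>2 / 2 - 2 * f j * f (j - 1))"
    using chain_energy_upto[of f "- int N" "int N"] by (simp add: f0)
  also have "\<dots> \<le> H N \<sigma> b"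
    unfolding H_def
  proof (rule sum_mono)
    fix j
    show "(f j)\<^sup>2 / 2 - 2 * f j * f (j - 1)
        \<le> 1/2 * cmod (entry \<sigma> b j) ^ 4 - 2 * Re ((cnj (entry \<sigma> b j))\<^sup>2 * (entry \<sigma> b (j - 1))\<^sup>2)"
      using complex_Re_le_cmod[of "(cnj (entry \<sigma> b j))\<^sup>2 * (entry \<sigma> b (j - 1))\<^sup>2"]
      by (simp add: f_def norm_mult norm_power flip: power_mult)
  qed
  finally show ?thesis .
qed

lemma entry_scale: "entry \<sigma> (z *s b) j = z * entry \<sigma> b j"
  by (simp add: entry_def vector_scalar_mult_def)

lemma H_phase_invariant:
  assumes "cmod z = 1"
  shows "H N \<sigma> (z *s b) = H N \<sigma> b"
proof -
  have z: "cnj z * z = 1"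
    using assms complex_norm_square[of z] by (simp add: mult.commute)
  have "(cnj (z * u))\<^sup>2 * (z * v)\<^sup>2 = (cnj z * z)\<^sup>2 * ((cnj u)\<^sup>2 * v\<^sup>2)" for u v
    by (simp add: power_mult_distrib algebra_simps)
  then have "(cnj (z * u))\<^sup>2 * (z * v)\<^sup>2 = (cnj u)\<^sup>2 * v\<^sup>2" for u v
    by (simp add: z)
  then show ?thesis
    using assms by (simp only: H_def entry_scale norm_mult mult_1)
qed

lemma M_phase_invariant: "cmod z = 1 \<Longrightarrow> M (z *s b) = M b"
  by (simp add: M_def norm_mult)

text \<open>
  Since \<open>k\<close> is an interior site, all three sites \<open>k - 1\<close>, \<open>k\<close>, \<open>k + 1\<close> exist and none of the mass
  is cut off at the ends of the chain.
\<close>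

lemma entry_bvec:
  assumes "bij_betw \<sigma> UNIV {- int N..int N}" and "k \<in> {- int N + 1..int N - 1}"
  shows "entry \<sigma> (bvec \<sigma> k m) j = (if j = k then of_real (sqrt (5 * m / 11))
           else if j = k - 1 \<or> j = k + 1 then of_real (sqrt (3 * m / 11)) else 0)"
proof -
  have r: "range \<sigma> = {- int N..int N}"
    using assms(1) by (auto simp: bij_betw_def)
  show ?thesis
  proof (cases "j \<in> range \<sigma>")
    case True
    then have "\<sigma> (inv \<sigma> j) = j"
      by (rule f_inv_into_f)
    then show ?thesis
      using True by (simp add: entry_def bvec_def)
  next
    case False
    then show ?thesis
      using assms(2) by (auto simp: entry_def r)
  qed
qed

text \<open>
  The lower bound is attained on every circle, with masses \<open>3m/11, 5m/11, 3m/11\<close>. Phase invariance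
  reduces this to the real vector \<open>bvec \<sigma> k m\<close>.
\<close>

lemma Bset_ground_state:
  assumes "bij_betw \<sigma> UNIV {- int N..int N}" and "k \<in> {- int N + 1..int N - 1}" and "0 \<le> m"
    and "b \<in> Bset \<sigma> k m"
  shows "M b = m" and "H N \<sigma> b = - (7/22) * m\<^sup>2"
proof -
  obtain \<theta> where b: "b = exp (\<i> * of_real \<theta>) *s bvec \<sigma> k m"
    using assms(4) by (auto simp: Bset_def)
  have z: "cmod (exp (\<i> * of_real \<theta>)) = 1" by simp
  have on_support: "(\<Sum>j = - int N..int N. g j) = g (k - 1) + g k + g (k + 1)"
    if "\<And>j. j \<notin> {k - 1, k, k + 1} \<Longrightarrow> g j = 0" for g :: "int \<Rightarrow> real"
  proof -
    have "(\<Sum>j = - int N..int N. g j) = sum g {k - 1, k, k + 1}"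
      using assms(2) that by (intro sum.mono_neutral_right) auto
    then show ?thesis by simp
  qed
  note entry = entry_bvec[OF assms(1,2), of m]
  have sq: "(sqrt (3 * m / 11))\<^sup>2 = 3 * m / 11" "(sqrt (5 * m / 11))\<^sup>2 = 5 * m / 11"
    using assms(3) by auto
  have quad: "(sqrt (3 * m / 11)) ^ 4 = (3 * m / 11)\<^sup>2" "(sqrt (5 * m / 11)) ^ 4 = (5 * m / 11)\<^sup>2"
    using sq by (metis (no_types) power_mult num_double numeral_times_numeral)+
  have "M b = M (bvec \<sigma> k m)"
    unfolding b by (rule M_phase_invariant[OF z])
  also have "\<dots> = m"
    unfolding M_eq_sum_entry[OF assms(1)]
    by (subst on_support) (use assms(3) in \<open>auto simp: entry\<close>)
  finally show "M b = m" .
  have "H N \<sigma> b = H N \<sigma> (bvec \<sigma> k m)"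
    unfolding b by (rule H_phase_invariant[OF z])
  also have "\<dots> = (3 * m / 11)\<^sup>2 + (5 * m / 11)\<^sup>2 / 2 - 4 * (5 * m / 11) * (3 * m / 11)"
    unfolding H_def
    by (subst on_support) (auto simp: entry quad sq simp flip: of_real_mult of_real_power)
  also have "\<dots> = - (7/22) * m\<^sup>2"
    by (simp add: field_simps power2_eq_square)
  finally show "H N \<sigma> b = - (7/22) * m\<^sup>2" .
qed

section \<open>Hessians at minimum points\<close>

text \<open>
  Restriction to a line gives the one-dimensional second-order condition. If the second derivative
  were negative at the critical point, the first derivative would be negative just after it, and the
  mean value theorem would give a smaller value of the function.
\<close>

lemma second_derivative_nonneg_at_minimum:
  fixes f :: "'a::real_inner \<Rightarrow> real"
  assumes grad: "\<And>y. GDERIV f y :> g y"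
    and hess: "(g has_derivative g') (at x)"
    and min: "\<And>y. f x \<le> f y"
  shows "0 \<le> g' v \<bullet> v"
proof (rule ccontr)
  assume neg: "\<not> 0 \<le> g' v \<bullet> v"
  have line: "((\<lambda>t. x + t *\<^sub>R v) has_derivative (\<lambda>s. s *\<^sub>R v)) (at t)" for t
    by (auto intro!: derivative_eq_intros)
  have d1: "((\<lambda>t. f (x + t *\<^sub>R v)) has_real_derivative g (x + t *\<^sub>R v) \<bullet> v) (at t)" for t
    using has_derivative_compose[OF line[of t] grad[unfolded gderiv_def, of "x + t *\<^sub>R v"]]
    by (rule has_derivative_imp_has_field_derivative) (simp add: inner_commute)
  have "((\<lambda>t. g (x + t *\<^sub>R v)) has_derivative (\<lambda>s. g' (s *\<^sub>R v))) (at 0)"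
    using has_derivative_compose[OF line[of 0], of g g'] hess by simp
  then have "((\<lambda>t. g (x + t *\<^sub>R v) \<bullet> v) has_derivative (\<lambda>s. g' (s *\<^sub>R v) \<bullet> v)) (at 0)"
    by (rule has_derivative_inner_left)
  then have d2: "((\<lambda>t. g (x + t *\<^sub>R v) \<bullet> v) has_real_derivative g' v \<bullet> v) (at 0)"
    using linear_scale[OF has_derivative_linear[OF hess]]
    by (intro has_derivative_imp_has_field_derivative) auto
  have "g (x + 0 *\<^sub>R v) \<bullet> v = 0"
    by (rule DERIV_local_min[OF d1, of 1]) (auto simp: min)
  then obtain \<delta> where \<delta>: "0 < \<delta>" "\<And>t. 0 < t \<Longrightarrow> t < \<delta> \<Longrightarrow> g (x + t *\<^sub>R v) \<bullet> v < 0"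
    using DERIV_neg_dec_right[OF d2] neg by auto
  obtain t where t: "0 < t" "t < \<delta> / 2"
    "f (x + (\<delta> / 2) *\<^sub>R v) - f (x + 0 *\<^sub>R v) = (\<delta> / 2 - 0) * (g (x + t *\<^sub>R v) \<bullet> v)"
    using MVT2[of 0 "\<delta> / 2", OF _ d1] \<delta>(1) by auto
  have "(\<delta> / 2) * (g (x + t *\<^sub>R v) \<bullet> v) < 0"
    using t \<delta> by (intro mult_pos_neg) auto
  then show False
    using t(3) min[of "x + (\<delta> / 2) *\<^sub>R v"] by simp
qed

lemma has_derivative_vec_lambda:
  fixes f :: "'n::finite \<Rightarrow> 'a::real_normed_vector \<Rightarrow> 'b::euclidean_space"
  assumes "\<And>i. (f i has_derivative f' i) (at x)"
  shows "((\<lambda>x. \<chi> i. f i x) has_derivative (\<lambda>h. \<chi> i. f' i h)) (at x)"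
  by (subst has_derivative_componentwise_within)
    (auto simp: Basis_vec_def inner_axis intro!: has_derivative_inner_left assms)

lemma gradient_eqI:
  assumes "GDERIV f x :> g"
  shows "gradient f x = g"
  unfolding gradient_def
proof (rule the_equality)
  fix g' assume "GDERIV f x :> g'"
  then have "(\<lambda>h. h \<bullet> g') = (\<lambda>h. h \<bullet> g)"
    using assms unfolding gderiv_def by (rule has_derivative_unique)
  then have "(g' - g) \<bullet> g' = (g' - g) \<bullet> g"
    by (rule fun_cong)
  then show "g' = g"
    by (metis eq_iff_diff_eq_0 inner_diff_right inner_eq_zero_iff)
qed (rule assms)

section \<open>Gradient and Hessian of H\<close>

lemma bounded_linear_entry: "bounded_linear (\<lambda>b. entry \<sigma> b j)"
  by (cases "j \<in> range \<sigma>") (simp_all add: entry_def bounded_linear_vec_nth)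

lemmas has_derivative_entry [derivative_intros] =
  bounded_linear.has_derivative[OF bounded_linear_entry]

lemma continuous_on_entry [continuous_intros]:
  "continuous_on A f \<Longrightarrow> continuous_on A (\<lambda>x. entry \<sigma> (f x) j)"
  by (rule bounded_linear.continuous_on[OF bounded_linear_entry])

definition H_grad :: "('n::finite \<Rightarrow> int) \<Rightarrow> complex^'n \<Rightarrow> complex^'n" where
  "H_grad \<sigma> b = (\<chi> i. let e = entry \<sigma> b; j = \<sigma> i in
     2 * (e j)\<^sup>2 * cnj (e j) - 4 * cnj (e j) * ((e (j - 1))\<^sup>2 + (e (j + 1))\<^sup>2))"

definition H_hess :: "('n::finite \<Rightarrow> int) \<Rightarrow> complex^'n \<Rightarrow> complex^'n \<Rightarrow> complex^'n" where
  "H_hess \<sigma> b v = (\<chi> i. let e = entry \<sigma> b; u = entry \<sigma> v; j = \<sigma> i in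
     4 * e j * u j * cnj (e j) + 2 * (e j)\<^sup>2 * cnj (u j)
     - 4 * cnj (u j) * ((e (j - 1))\<^sup>2 + (e (j + 1))\<^sup>2)
     - 8 * cnj (e j) * (e (j - 1) * u (j - 1) + e (j + 1) * u (j + 1)))"

text \<open>
  Both boundary terms vanish, so the index can be shifted. A site occurs in \<open>H\<close> both as
  the right and as the left partner of an interaction, and shifting one of the two sums
  lets the gradient collect both contributions at the same site.
\<close>

lemma sum_shift_int:
  fixes f :: "int \<Rightarrow> 'a::comm_monoid_add"
  assumes "f a = 0" and "f (b + 1) = 0"
  shows "(\<Sum>j = a..b. f (j + 1)) = (\<Sum>j = a..b. f j)"
proof -
  have "(\<Sum>j = a..b. f (j + 1)) = (\<Sum>j = a + 1..b + 1. f j)"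
    by (rule sum.reindex_bij_witness[of _ "\<lambda>j. j - 1" "\<lambda>j. j + 1"]) auto
  also have "\<dots> = (\<Sum>j = a..b + 1. f j)"
  proof (rule sum.mono_neutral_left)
    show "\<forall>j\<in>{a..b + 1} - {a + 1..b + 1}. f j = 0"
    proof
      fix j assume "j \<in> {a..b + 1} - {a + 1..b + 1}"
      then have "j = a" by auto
      then show "f j = 0" using assms(1) by simp
    qed
  qed auto
  also have "\<dots> = (\<Sum>j = a..b. f j)"
  proof (rule sum.mono_neutral_right)
    show "\<forall>j\<in>{a..b + 1} - {a..b}. f j = 0"
    proof
      fix j assume "j \<in> {a..b + 1} - {a..b}"
      then have "j = b + 1" by auto
      then show "f j = 0" using assms(2) by simp
    qed
  qed auto
  finally show ?thesis .
qed

lemma GDERIV_H: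
  assumes "bij_betw \<sigma> UNIV {- int N..int N}"
  shows "GDERIV (H N \<sigma>) b :> H_grad \<sigma> b"
proof -
  have r: "range \<sigma> = {- int N..int N}" and "inj \<sigma>"
    using assms by (auto simp: bij_betw_def)
  let ?e = "entry \<sigma> b"
  \<comment> \<open>In terms of the real inner product of complex numbers, \<open>Re (cnj u * w) = u \<bullet> w\<close>, the product
     rules for derivatives apply directly.\<close>
  have H: "H N \<sigma> = (\<lambda>b. \<Sum>j = - int N..int N. 1/2 * (entry \<sigma> b j \<bullet> entry \<sigma> b j)\<^sup>2
      - 2 * ((entry \<sigma> b j)\<^sup>2 \<bullet> (entry \<sigma> b (j - 1))\<^sup>2))"
    unfolding H_def
    by (rule ext, rule sum.cong)
      (simp_all add: power2_norm_eq_inner[symmetric] inner_complex_def flip: complex_cnj_power)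
  have "(H N \<sigma> has_derivative (\<lambda>h. \<Sum>j = - int N..int N.
      2 * (?e j \<bullet> ?e j) * (?e j \<bullet> entry \<sigma> h j) - 4 * ((?e j * entry \<sigma> h j) \<bullet> (?e (j - 1))\<^sup>2)
      - 4 * ((?e j)\<^sup>2 \<bullet> (?e (j - 1) * entry \<sigma> h (j - 1))))) (at b)"
    unfolding H
    by (rule has_derivative_sum)
      (auto intro!: derivative_eq_intros simp: inner_complex_def algebra_simps)
  also have "(\<lambda>h. \<Sum>j = - int N..int N.
      2 * (?e j \<bullet> ?e j) * (?e j \<bullet> entry \<sigma> h j) - 4 * ((?e j * entry \<sigma> h j) \<bullet> (?e (j - 1))\<^sup>2)
      - 4 * ((?e j)\<^sup>2 \<bullet> (?e (j - 1) * entry \<sigma> h (j - 1)))) = (\<lambda>h. h \<bullet> H_grad \<sigma> b)"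
  proof
    fix h
    let ?u = "entry \<sigma> h"
    have "(\<Sum>j = - int N..int N. (?e (j + 1))\<^sup>2 \<bullet> (?e j * ?u j))
        = (\<Sum>j = - int N..int N. (?e j)\<^sup>2 \<bullet> (?e (j - 1) * ?u (j - 1)))"
      using sum_shift_int[of "\<lambda>j. (?e j)\<^sup>2 \<bullet> (?e (j - 1) * ?u (j - 1))" "- int N" "int N"]
      by (simp add: entry_def r)
    then have "(\<Sum>j = - int N..int N. 2 * (?e j \<bullet> ?e j) * (?e j \<bullet> ?u j)
          - 4 * ((?e j * ?u j) \<bullet> (?e (j - 1))\<^sup>2) - 4 * ((?e j)\<^sup>2 \<bullet> (?e (j - 1) * ?u (j - 1))))
        = (\<Sum>j = - int N..int N. 2 * (?e j \<bullet> ?e j) * (?e j \<bullet> ?u j)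
          - 4 * ((?e j * ?u j) \<bullet> (?e (j - 1))\<^sup>2) - 4 * ((?e (j + 1))\<^sup>2 \<bullet> (?e j * ?u j)))"
      by (simp add: sum_subtractf sum_distrib_left[symmetric])
    also have "\<dots> = (\<Sum>j = - int N..int N. ?u j \<bullet>
        (2 * (?e j)\<^sup>2 * cnj (?e j) - 4 * cnj (?e j) * ((?e (j - 1))\<^sup>2 + (?e (j + 1))\<^sup>2)))"
      by (rule sum.cong) (simp_all add: inner_complex_def power2_eq_square algebra_simps)
    also have "\<dots> = (\<Sum>i\<in>UNIV. ?u (\<sigma> i) \<bullet> H_grad \<sigma> b $ i)"
      unfolding H_grad_def Let_def vec_lambda_beta
      by (rule sum.reindex_bij_betw[OF assms, symmetric])
    also have "\<dots> = h \<bullet> H_grad \<sigma> b"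
      using \<open>inj \<sigma>\<close> by (simp add: inner_vec_def entry_def)
    finally show "(\<Sum>j = - int N..int N. 2 * (?e j \<bullet> ?e j) * (?e j \<bullet> ?u j)
          - 4 * ((?e j * ?u j) \<bullet> (?e (j - 1))\<^sup>2) - 4 * ((?e j)\<^sup>2 \<bullet> (?e (j - 1) * ?u (j - 1))))
        = h \<bullet> H_grad \<sigma> b" .
  qed
  finally show ?thesis
    by (simp add: gderiv_def)
qed

lemma has_derivative_H_grad: "(H_grad \<sigma> has_derivative H_hess \<sigma> b) (at b)"
  unfolding H_grad_def H_hess_def Let_def
  by (rule has_derivative_vec_lambda)
    (auto intro!: derivative_eq_intros simp: power2_eq_square algebra_simps)

lemma hessian_H:
  assumes "bij_betw \<sigma> UNIV {- int N..int N}"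
  shows "hessian (H N \<sigma>) = H_hess \<sigma>"
proof -
  have "gradient (H N \<sigma>) = H_grad \<sigma>"
    using gradient_eqI[OF GDERIV_H[OF assms]] by (rule ext)
  then show ?thesis
    by (intro ext) (simp add: hessian_def frechet_derivative_at[OF has_derivative_H_grad, symmetric])
qed

section \<open>Nonnegativity of the quadratic exponents\<close>

lemma Proj_perp_orthogonal: "bhat b \<bullet> Proj_perp bhat b = 0"
  by (cases "bhat b = 0")
    (simp_all add: Proj_perp_def Proj_def inner_diff_right inner_commute power2_norm_eq_inner[symmetric]
      power2_eq_square field_simps)

text \<open>
  The point \<open>bhat b\<close> minimises \<open>H + 7/22 M\<^sup>2\<close> over the whole space, with value \<open>0\<close>. Replacing the
  constraint to the sphere by this homogeneous penalty makes the unconstrained second-order condition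
  available; \<open>2 G\<close> is the Hessian of the penalised function in the direction \<open>Proj_perp bhat b\<close>.
\<close>

lemma G_nonneg:
  assumes \<sigma>: "bij_betw \<sigma> UNIV {- int N..int N}" and k: "k \<in> {- int N + 1..int N - 1}" and "0 \<le> m"
    and "b \<in> S m" and "bhat b \<in> Bset \<sigma> k m"
  shows "0 \<le> G N \<sigma> bhat b"
proof -
  define x v where "x = bhat b" and "v = Proj_perp bhat b"
  note ground = Bset_ground_state[OF \<sigma> k \<open>0 \<le> m\<close> assms(5), folded x_def]
  have Mb: "M b = x \<bullet> x"
    using ground(1) \<open>b \<in> S m\<close> by (simp add: S_def M_eq_norm power2_norm_eq_inner)
  define f where "f y = H N \<sigma> y + 7/22 * (y \<bullet> y)\<^sup>2" for y
  define g where "g y = H_grad \<sigma> y + (14/11 * (y \<bullet> y)) *\<^sub>R y" for y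
  have "GDERIV f y :> g y" for y
    unfolding gderiv_def f_def g_def
    by (auto intro!: derivative_eq_intros GDERIV_H[OF \<sigma>, unfolded gderiv_def]
        simp: inner_add_right inner_commute)
  moreover have "(g has_derivative (\<lambda>h. H_hess \<sigma> x h + ((14/11 * (x \<bullet> x)) *\<^sub>R h + (28/11 * (x \<bullet> h)) *\<^sub>R x))) (at x)"
    unfolding g_def
    by (auto intro!: derivative_eq_intros has_derivative_H_grad simp: inner_commute algebra_simps)
  moreover have "f x \<le> f y" for y
    using H_lower_bound[OF \<sigma>, of y] ground
    by (simp add: f_def M_eq_norm power2_norm_eq_inner)
  ultimately have "0 \<le> (H_hess \<sigma> x v + ((14/11 * (x \<bullet> x)) *\<^sub>R v + (28/11 * (x \<bullet> v)) *\<^sub>R x)) \<bullet> v"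
    by (rule second_derivative_nonneg_at_minimum)
  then show ?thesis
    using Proj_perp_orthogonal[of bhat b]
    by (simp add: G_def hessian_H[OF \<sigma>] Mb x_def v_def inner_add_left)
qed

section \<open>Integration over the sphere\<close>

lemma borel_measurable_surface_measureI:
  assumes "continuous_on (S m) f"
  shows "f \<in> borel_measurable (surface_measure m)"
  using borel_measurable_continuous_on_restrict[OF assms]
  by (simp add: measurable_cong_sets[OF sets_surface_measure refl])

text \<open>
  The Hessian of \<open>H\<close> depends jointly continuously on the base point and on the direction, so
  measurability of the selection \<open>bhat\<close> passes on to \<open>G\<close>.
\<close>

lemma borel_measurable_G:
  assumes \<sigma>: "bij_betw \<sigma> UNIV {- int N..int N}"
    and [measurable]: "bhat \<in> borel_measurable (surface_measure m)"
  shows "G N \<sigma> bhat \<in> borel_measurable (surface_measure m)"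
proof -
  have [measurable]: "(\<lambda>b. b) \<in> borel_measurable (surface_measure m)"
    by (rule borel_measurable_surface_measureI) (rule continuous_on_id)
  have [measurable]: "Proj_perp bhat \<in> borel_measurable (surface_measure m)"
    unfolding Proj_perp_def Proj_def by measurable
  have "continuous_on UNIV (\<lambda>p. H_hess \<sigma> (fst p) (snd p))"
    unfolding H_hess_def Let_def by (intro continuous_intros)
  then have [measurable]:
    "(\<lambda>b. H_hess \<sigma> (bhat b) (Proj_perp bhat b)) \<in> borel_measurable (surface_measure m)"
    by (rule borel_measurable_continuous_Pair[rotated 2]) measurable
  show ?thesis
    unfolding G_def hessian_H[OF \<sigma>] M_eq_norm by measurable
qed

lemma smooth_on_imp_continuous_on:
  assumes "smooth_on X f"
  shows "continuous_on X f"
  unfolding continuous_on_eq_continuous_within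
proof
  fix x assume "x \<in> X"
  then obtain U g where U: "open U" "x \<in> U" "Ck_on 0 g U" "\<forall>y\<in>X \<inter> U. g y = f y"
    using assms unfolding smooth_on_def by meson
  have "continuous_on (X \<inter> U) g"
    using U(3) by (auto intro: continuous_on_subset)
  then have "continuous_on (X \<inter> U) f"
    using U(4) by (subst continuous_on_cong[OF refl, of _ f g]) auto
  then have "continuous (at x within X \<inter> U) f"
    using \<open>x \<in> X\<close> U(2) by (simp add: continuous_on_eq_continuous_within)
  moreover have "at x within X \<inter> U = at x within X"
    using U(1,2) by (intro at_within_nhd[of x U]) auto
  ultimately show "continuous (at x within X) f"
    by simp
qed

lemma Linf_norm_nonneg: "0 \<le> Linf_norm \<Gamma> \<phi>"
  by (simp add: Linf_norm_def)

text \<open>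
  Boundedness makes the essential supremum finite, so that its conversion to a real number
  does not return the default value \<open>0\<close>.
\<close>

lemma AE_le_Linf_norm:
  assumes [measurable]: "\<phi> \<in> borel_measurable \<Gamma>" and "bounded (\<phi> ` space \<Gamma>)"
  shows "AE b in \<Gamma>. \<bar>\<phi> b\<bar> \<le> Linf_norm \<Gamma> \<phi>"
proof -
  obtain K where K: "\<forall>b\<in>space \<Gamma>. \<bar>\<phi> b\<bar> \<le> K"
    using assms(2) by (auto simp: bounded_iff)
  have "esssup \<Gamma> (\<lambda>b. ennreal \<bar>\<phi> b\<bar>) \<le> ennreal K"
    by (rule esssup_I) (use K in \<open>auto intro!: AE_I2 ennreal_leI\<close>)
  then have "esssup \<Gamma> (\<lambda>b. ennreal \<bar>\<phi> b\<bar>) < top"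
    by (rule le_less_trans) simp
  then have "ennreal (Linf_norm \<Gamma> \<phi>) = esssup \<Gamma> (\<lambda>b. ennreal \<bar>\<phi> b\<bar>)"
    by (simp add: Linf_norm_def)
  then have "AE b in \<Gamma>. ennreal \<bar>\<phi> b\<bar> \<le> ennreal (Linf_norm \<Gamma> \<phi>)"
    using esssup_AE[of "\<lambda>b. ennreal \<bar>\<phi> b\<bar>" \<Gamma>] by simp
  then show ?thesis
    by (simp add: Linf_norm_nonneg)
qed

text \<open>A function that is not integrable has integral \<open>0\<close>, so the bound holds for it as well.\<close>

lemma (in finite_measure) abs_integral_le_AE_bound:
  fixes f :: "'a \<Rightarrow> real"
  assumes "AE x in M. \<bar>f x\<bar> \<le> B" and "0 \<le> B"
  shows "\<bar>\<integral>x. f x \<partial>M\<bar> \<le> B * measure M (space M)"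
proof (cases "integrable M f")
  case True
  have "\<bar>\<integral>x. f x \<partial>M\<bar> \<le> (\<integral>x. \<bar>f x\<bar> \<partial>M)"
    by simp
  also have "\<dots> \<le> (\<integral>x. B \<partial>M)"
    using True assms by (intro integral_mono_AE) auto
  finally show ?thesis
    by (simp add: mult.commute)
qed (use assms in \<open>simp add: not_integrable_integral_eq\<close>)

lemma finite_measure_surface_measure:
  assumes "m > 0" and "CARD('n::finite) = 2 * N + 1"
  shows "finite_measure (surface_measure m :: (complex^'n) measure)"
  by (rule finite_measureI) (simp add: surface_measure_total_mass[OF assms])

text \<open>
  The common bound for all the integrals that are compared: it is applied with \<open>H - h_star m\<close> and
  with each of the \<open>G\<^sub>k\<close> in the place of \<open>h\<close>.
\<close>

lemma abs_integral_exp_le: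
  fixes h \<phi> :: "complex^'n::finite \<Rightarrow> real"
  assumes "m > 0" and "CARD('n) = 2 * N + 1"
    and nonneg: "\<And>b. b \<in> S m \<Longrightarrow> 0 \<le> h b" and "0 \<le> \<beta>"
    and \<phi>: "\<phi> \<in> borel_measurable (surface_measure m)" "bounded (\<phi> ` S m)"
  shows "\<bar>\<integral>b. exp (- \<beta> * h b) * \<phi> b \<partial>surface_measure m\<bar>
    \<le> Linf_norm (surface_measure m) \<phi> * measure (surface_measure m) (S m :: (complex^'n) set)"
proof -
  interpret finite_measure "surface_measure m :: (complex^'n) measure"
    using assms(1,2) by (rule finite_measure_surface_measure)
  have "AE b in surface_measure m. \<bar>\<phi> b\<bar> \<le> Linf_norm (surface_measure m) \<phi>"
    using \<phi> by (intro AE_le_Linf_norm) auto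
  then have "AE b in surface_measure m. \<bar>exp (- \<beta> * h b) * \<phi> b\<bar> \<le> Linf_norm (surface_measure m) \<phi>"
    using AE_space
  proof eventually_elim
    case (elim b)
    then have "exp (- \<beta> * h b) \<le> 1"
      using nonneg[of b] \<open>0 \<le> \<beta>\<close> by simp
    then have "exp (- \<beta> * h b) * \<bar>\<phi> b\<bar> \<le> 1 * Linf_norm (surface_measure m) \<phi>"
      using elim by (intro mult_mono) auto
    then show ?case
      by (simp add: abs_mult)
  qed
  from abs_integral_le_AE_bound[OF this Linf_norm_nonneg] show ?thesis
    by simp
qed

lemma integral_gamma_hat:
  assumes "m > 0" and card: "CARD('n::finite) = 2 * N + 1" and \<sigma>: "bij_betw \<sigma> UNIV {- int N..int N}"
    and bhat: "\<forall>k\<in>{- int N + 1..int N - 1}. nearest_point_selection \<sigma> k m (bhat k)"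
    and G0: "\<And>k b. k \<in> {- int N + 1..int N - 1} \<Longrightarrow> b \<in> S m \<Longrightarrow> 0 \<le> G N \<sigma> (bhat k) b"
    and "0 \<le> \<beta>"
    and \<phi>[measurable]: "\<phi> \<in> borel_measurable (surface_measure m)" and bdd: "bounded (\<phi> ` S m)"
  shows "(\<integral>b. \<phi> b \<partial>gamma_hat N \<sigma> bhat \<beta> m)
    = (\<Sum>k = - int N + 1..int N - 1.
        \<integral>b. exp (- \<beta> * G N \<sigma> (bhat k) b) * \<phi> b \<partial>(surface_measure m :: (complex^'n) measure))"
proof -
  interpret finite_measure "surface_measure m :: (complex^'n) measure"
    using assms(1,2) by (rule finite_measure_surface_measure)
  have [measurable]: "G N \<sigma> (bhat k) \<in> borel_measurable (surface_measure m)"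
    if "k \<in> {- int N + 1..int N - 1}" for k
    using bhat that by (intro borel_measurable_G[OF \<sigma>]) (simp add: nearest_point_selection_def)
  obtain K where K: "\<forall>b\<in>S m. \<bar>\<phi> b\<bar> \<le> K"
    using bdd by (auto simp: bounded_iff)
  have int: "integrable (surface_measure m) (\<lambda>b. exp (- \<beta> * G N \<sigma> (bhat k) b) * \<phi> b)"
    if k: "k \<in> {- int N + 1..int N - 1}" for k
  proof (rule integrable_const_bound[of _ K])
    show "AE b in surface_measure m. norm (exp (- \<beta> * G N \<sigma> (bhat k) b) * \<phi> b) \<le> K"
      using AE_space
    proof eventually_elim
      case (elim b)
      then have "exp (- \<beta> * G N \<sigma> (bhat k) b) * \<bar>\<phi> b\<bar> \<le> 1 * K"
        using G0[OF k, of b] \<open>0 \<le> \<beta>\<close> K by (intro mult_mono) auto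
      then show ?case
        by (simp add: abs_mult)
    qed
  qed (use k in measurable)
  have "(\<integral>b. \<phi> b \<partial>gamma_hat N \<sigma> bhat \<beta> m)
      = (\<integral>b. (\<Sum>k = - int N + 1..int N - 1. exp (- \<beta> * G N \<sigma> (bhat k) b)) *\<^sub>R \<phi> b \<partial>surface_measure m)"
    unfolding gamma_hat_def by (rule integral_density) (auto intro!: sum_nonneg AE_I2)
  also have "\<dots> = (\<integral>b. (\<Sum>k = - int N + 1..int N - 1. exp (- \<beta> * G N \<sigma> (bhat k) b) * \<phi> b)
      \<partial>surface_measure m)"
    by (simp add: sum_distrib_right)
  also have "\<dots> = (\<Sum>k = - int N + 1..int N - 1.
      \<integral>b. exp (- \<beta> * G N \<sigma> (bhat k) b) * \<phi> b \<partial>surface_measure m)"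
    using int by (rule Bochner_Integration.integral_sum)
  finally show ?thesis .
qed

section \<open>Comparison of the two measures\<close>

theorem theorem7:
  fixes N :: nat and m :: real
  assumes "N \<ge> 1" and "m > 0" and "CARD('n::finite) = 2 * N + 1"
  shows "\<exists>C>0. \<forall>(\<sigma> :: 'n \<Rightarrow> int) (bhat :: int \<Rightarrow> complex^'n \<Rightarrow> complex^'n).
    bij_betw \<sigma> UNIV {- int N..int N} \<longrightarrow>
    (\<forall>k\<in>{- int N + 1..int N - 1}. nearest_point_selection \<sigma> k m (bhat k)) \<longrightarrow>
    (\<exists>Error :: real \<Rightarrow> (complex^'n \<Rightarrow> real) \<Rightarrow> real.
      (\<forall>\<beta>>0. \<forall>\<phi>. test_function m \<phi> \<longrightarrow>
         exp (\<beta> * h_star m) / \<beta> ^ N * mu N \<sigma> \<beta> m \<phi>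
           = 1 / \<beta> ^ N * (\<integral>b. exp (- \<beta> * (H N \<sigma> b - h_star m)) * \<phi> b \<partial>surface_measure m) \<and>
         1 / \<beta> ^ N * (\<integral>b. exp (- \<beta> * (H N \<sigma> b - h_star m)) * \<phi> b \<partial>surface_measure m)
           = 1 / \<beta> ^ N * (\<integral>b. \<phi> b \<partial>gamma_hat N \<sigma> bhat \<beta> m) + Error \<beta> \<phi>) \<and>
      (\<forall>\<^sub>F \<beta> in at_top. \<forall>\<phi>. test_function m \<phi> \<longrightarrow>
         \<bar>Error \<beta> \<phi>\<bar> \<le> C * (1 / \<beta>) * Linf_norm (surface_measure m) \<phi>))"
proof -
  define A where "A = measure (surface_measure m) (S m :: (complex^'n) set)"
  \<comment> \<open>One integral comes from \<open>H\<close> and \<open>2N - 1\<close> come from the circles, which makes \<open>2N\<close> multiples of the area.\<close>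
  define C where "C = 2 * real N * A + 1"
  have "0 \<le> A"
    by (simp add: A_def)
  then have "C > 0"
    by (simp add: C_def add_nonneg_pos)
  moreover have "\<exists>Error :: real \<Rightarrow> (complex^'n \<Rightarrow> real) \<Rightarrow> real.
      (\<forall>\<beta>>0. \<forall>\<phi>. test_function m \<phi> \<longrightarrow>
         exp (\<beta> * h_star m) / \<beta> ^ N * mu N \<sigma> \<beta> m \<phi>
           = 1 / \<beta> ^ N * (\<integral>b. exp (- \<beta> * (H N \<sigma> b - h_star m)) * \<phi> b \<partial>surface_measure m) \<and>
         1 / \<beta> ^ N * (\<integral>b. exp (- \<beta> * (H N \<sigma> b - h_star m)) * \<phi> b \<partial>surface_measure m)
           = 1 / \<beta> ^ N * (\<integral>b. \<phi> b \<partial>gamma_hat N \<sigma> bhat \<beta> m) + Error \<beta> \<phi>) \<and>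
      (\<forall>\<^sub>F \<beta> in at_top. \<forall>\<phi>. test_function m \<phi> \<longrightarrow>
         \<bar>Error \<beta> \<phi>\<bar> \<le> C * (1 / \<beta>) * Linf_norm (surface_measure m) \<phi>)"
    if \<sigma>: "bij_betw \<sigma> UNIV {- int N..int N}"
      and bhat: "\<forall>k\<in>{- int N + 1..int N - 1}. nearest_point_selection \<sigma> k m (bhat k)"
    for \<sigma> :: "'n \<Rightarrow> int" and bhat :: "int \<Rightarrow> complex^'n \<Rightarrow> complex^'n"
  proof -
    define I where "I \<beta> \<phi> = (\<integral>b. exp (- \<beta> * (H N \<sigma> b - h_star m)) * \<phi> b \<partial>surface_measure m)"
      for \<beta> and \<phi> :: "complex^'n \<Rightarrow> real"
    define J where "J \<beta> \<phi> = (\<integral>b. \<phi> b \<partial>gamma_hat N \<sigma> bhat \<beta> m)"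
      for \<beta> and \<phi> :: "complex^'n \<Rightarrow> real"
    define Error where "Error \<beta> \<phi> = 1 / \<beta> ^ N * (I \<beta> \<phi> - J \<beta> \<phi>)"
      for \<beta> and \<phi> :: "complex^'n \<Rightarrow> real"
    have mu: "exp (\<beta> * h_star m) * mu N \<sigma> \<beta> m \<phi> = I \<beta> \<phi>" for \<beta> \<phi>
    proof -
      have "exp (\<beta> * h_star m) * (\<phi> b * exp (- \<beta> * H N \<sigma> b))
          = exp (- \<beta> * (H N \<sigma> b - h_star m)) * \<phi> b" for b
      proof -
        have "exp (- \<beta> * (H N \<sigma> b - h_star m)) = exp (\<beta> * h_star m) * exp (- \<beta> * H N \<sigma> b)"
          by (simp add: algebra_simps flip: exp_add)
        then show ?thesis
          by simp
      qed
      then have "I \<beta> \<phi>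
          = (\<integral>b. exp (\<beta> * h_star m) * (\<phi> b * exp (- \<beta> * H N \<sigma> b)) \<partial>surface_measure m)"
        by (simp only: I_def)
      then show ?thesis
        by (simp only: mu_def integral_mult_right_zero)
    qed
    have H0: "0 \<le> H N \<sigma> b - h_star m" if "b \<in> S m" for b
      using H_lower_bound[OF \<sigma>, of b] that by (simp add: S_def h_star_def)
    have G0: "0 \<le> G N \<sigma> (bhat k) b" if "k \<in> {- int N + 1..int N - 1}" "b \<in> S m" for k b
      using that bhat \<open>m > 0\<close>
      by (intro G_nonneg[OF \<sigma>, of k m]) (auto simp: nearest_point_selection_def is_arg_min_def)
    have bound: "\<bar>Error \<beta> \<phi>\<bar> \<le> C * (1 / \<beta>) * Linf_norm (surface_measure m) \<phi>"
      if "1 \<le> \<beta>" and "test_function m \<phi>" for \<beta> \<phi>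
    proof -
      define L where "L = Linf_norm (surface_measure m) \<phi>"
      have "0 \<le> L"
        by (simp add: L_def Linf_norm_nonneg)
      have \<phi>: "\<phi> \<in> borel_measurable (surface_measure m)" "bounded (\<phi> ` S m)"
        using \<open>test_function m \<phi>\<close>
        by (auto simp: test_function_def smooth_on_imp_continuous_on borel_measurable_surface_measureI)
      have "0 \<le> \<beta>" using \<open>1 \<le> \<beta>\<close> by simp
      have "\<bar>I \<beta> \<phi>\<bar> \<le> L * A"
        unfolding I_def L_def A_def
        by (rule abs_integral_exp_le[OF assms(2,3) H0 \<open>0 \<le> \<beta>\<close> \<phi>])
      moreover have "\<bar>J \<beta> \<phi>\<bar> \<le> (2 * real N - 1) * (L * A)"
      proof -
        have "J \<beta> \<phi> = (\<Sum>k = - int N + 1..int N - 1.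
            \<integral>b. exp (- \<beta> * G N \<sigma> (bhat k) b) * \<phi> b \<partial>surface_measure m)"
          unfolding J_def by (rule integral_gamma_hat[OF assms(2,3) \<sigma> bhat G0 \<open>0 \<le> \<beta>\<close> \<phi>])
        then have "\<bar>J \<beta> \<phi>\<bar> \<le> (\<Sum>k = - int N + 1..int N - 1.
            \<bar>\<integral>b. exp (- \<beta> * G N \<sigma> (bhat k) b) * \<phi> b \<partial>surface_measure m\<bar>)"
          by (simp only: sum_abs)
        also have "\<dots> \<le> (\<Sum>k = - int N + 1..int N - 1. L * A)"
          unfolding L_def A_def
          by (intro sum_mono abs_integral_exp_le[OF assms(2,3) G0 \<open>0 \<le> \<beta>\<close> \<phi>])
        also have "\<dots> = (2 * real N - 1) * (L * A)"
          using \<open>N \<ge> 1\<close> by (simp add: nat_diff_distrib nat_mult_distrib of_nat_diff)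
        finally show ?thesis .
      qed
      ultimately have "\<bar>I \<beta> \<phi> - J \<beta> \<phi>\<bar> \<le> C * L"
        using \<open>0 \<le> L\<close> by (simp add: C_def algebra_simps)
      moreover have "1 / \<beta> ^ N \<le> 1 / \<beta>"
        using \<open>1 \<le> \<beta>\<close> \<open>N \<ge> 1\<close> self_le_power[of \<beta> N] by (simp add: frac_le)
      ultimately have "1 / \<beta> ^ N * \<bar>I \<beta> \<phi> - J \<beta> \<phi>\<bar> \<le> 1 / \<beta> * (C * L)"
        using \<open>1 \<le> \<beta>\<close> by (intro mult_mono) auto
      then show ?thesis
        using \<open>1 \<le> \<beta>\<close> by (simp add: Error_def L_def abs_mult mult_ac)
    qed
    show ?thesis
    proof (intro exI[of _ Error] conjI allI impI)
      fix \<beta> :: real and \<phi> :: "complex^'n \<Rightarrow> real"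
      show "exp (\<beta> * h_star m) / \<beta> ^ N * mu N \<sigma> \<beta> m \<phi>
          = 1 / \<beta> ^ N * (\<integral>b. exp (- \<beta> * (H N \<sigma> b - h_star m)) * \<phi> b \<partial>surface_measure m)"
        unfolding I_def[symmetric] mu[symmetric] by simp
      show "1 / \<beta> ^ N * (\<integral>b. exp (- \<beta> * (H N \<sigma> b - h_star m)) * \<phi> b \<partial>surface_measure m)
          = 1 / \<beta> ^ N * (\<integral>b. \<phi> b \<partial>gamma_hat N \<sigma> bhat \<beta> m) + Error \<beta> \<phi>"
        unfolding I_def[symmetric] J_def[symmetric] Error_def by (simp add: right_diff_distrib)
    next
      show "\<forall>\<^sub>F \<beta> in at_top. \<forall>\<phi>. test_function m \<phi> \<longrightarrow>
          \<bar>Error \<beta> \<phi>\<bar> \<le> C * (1 / \<beta>) * Linf_norm (surface_measure m) \<phi>"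
        using eventually_ge_at_top[of 1] by eventually_elim (use bound in blast)
    qed
  qed
  ultimately show ?thesis
    by blast
qed

end
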